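(* Let $p<q$ be prime numbers with $p\ge 5$, let $\lfloor q/p\rfloor$ be the quotient and let $r$ be the remainder of the division of $q$ by $p$. Then the second gap of the binary cyclotomic polynomial $\Phi_{pq}$ is $g_2(\Phi_{pq})=\max\{r-1,\,p-r-1\}$. Moreover, $\Phi_{pq}$ has at least $2\lfloor q/p\rfloor$ gaps of this length.
   Context: $\Phi_n(X)\in\mathbb{Z}[X]$ denotes the cyclotomic polynomial of order $n$. For a polynomial $\Phi=c_nX^{e_n}+c_{n-1}X^{e_{n-1}}+\cdots+c_0X^{e_0}$ with all $c_j$ nonzero and $e_n>e_{n-1}>\cdots>e_0$, the gapset is $G(\Phi)=\{e_{j+1}-e_j: 0\le j\le n-1\}$. Each element of $G(\Phi)$ different from $1$ is called a gap (or the length of a gap). The number of gaps of length $\ell\ge 2$ of $\Phi$ is the number of indices $j\in\{0,\dots,n-1\}$ with $e_{j+1}-e_j=\ell$. The first (maximum) gap is $g_1(\Phi_{pq})=\max G(\Phi_{pq})$. If $G(\Phi_{pq})\setminus\{g_1(\Phi_{pq})\}$ has elements distinct from $1$, the second gap is $g_2(\Phi_{pq})=\max\big(G(\Phi_{pq})\setminus\{g_1(\Phi_{pq})\}\big)$ (the theorem includes the assertion that the second gap exists). *)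

theory Defs
  imports Complex_Main "HOL-Computational_Algebra.Computational_Algebra"
begin

definition primitive_roots_of_unity :: "nat \<Rightarrow> complex set" where
  "primitive_roots_of_unity n = {z. z ^ n = 1 \<and> (\<forall>m. 0 < m \<and> m < n \<longrightarrow> z ^ m \<noteq> 1)}"

definition complex_cyclotomic :: "nat \<Rightarrow> complex poly" where
  "complex_cyclotomic n = (\<Prod>z\<in>primitive_roots_of_unity n. [:- z, 1:])"

text \<open>
  The polynomial in $\mathbb{Z}[X]$ whose image in $\mathbb{C}[X]$ is the product above.  That it
  exists and is unique for \<open>n > 0\<close> is lemma \<open>map_poly_cyclotomic\<close> below.
\<close>
definition cyclotomic :: "nat \<Rightarrow> int poly" where
  "cyclotomic n = (THE f. map_poly of_int f = complex_cyclotomic n)"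

definition exponents :: "'a::zero poly \<Rightarrow> nat list" where
  "exponents f = sorted_list_of_set {i. coeff f i \<noteq> 0}"

text \<open>\<open>gap_at f j\<close> is $e_{j+1} - e_j$; it is meaningful only for \<open>Suc j < length (exponents f)\<close>.\<close>
definition gap_at :: "'a::zero poly \<Rightarrow> nat \<Rightarrow> nat" where
  "gap_at f j = exponents f ! Suc j - exponents f ! j"

definition gapset :: "'a::zero poly \<Rightarrow> nat set" where
  "gapset f = {gap_at f j | j. Suc j < length (exponents f)}"

definition number_of_gaps :: "'a::zero poly \<Rightarrow> nat \<Rightarrow> nat" where
  "number_of_gaps f l = card {j. Suc j < length (exponents f) \<and> gap_at f j = l}"

definition first_gap :: "'a::zero poly \<Rightarrow> nat" where
  "first_gap f = Max (gapset f)"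

definition has_second_gap :: "'a::zero poly \<Rightarrow> bool" where
  "has_second_gap f \<longleftrightarrow> (\<exists>l \<in> gapset f - {first_gap f}. l \<noteq> 1)"

text \<open>Only meaningful if \<open>has_second_gap f\<close> holds.\<close>
definition second_gap :: "'a::zero poly \<Rightarrow> nat" where
  "second_gap f = Max (gapset f - {first_gap f})"


lemma primitive_roots_disjoint:
  assumes "z \<in> primitive_roots_of_unity d" "z \<in> primitive_roots_of_unity e" "d > 0" "e > 0"
  shows "d = e"
  using assms unfolding primitive_roots_of_unity_def by (metis (mono_tags, lifting) mem_Collect_eq linorder_neqE_nat)

lemma roots_of_unity_eq_Union:
  assumes "n > 0"
  shows "{z. z ^ n = 1} = (\<Union>d\<in>{d. d dvd n}. primitive_roots_of_unity d)"
proof (intro equalityI subsetI)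
  fix z :: complex assume "z \<in> {z. z ^ n = 1}"
  hence z: "z ^ n = 1" by simp
  define d where "d = (LEAST m. m > 0 \<and> z ^ m = 1)"
  have d: "d > 0 \<and> z ^ d = 1"
    unfolding d_def by (rule LeastI[of _ n]) (use z assms in auto)
  have min: "z ^ m \<noteq> 1" if "0 < m" "m < d" for m
    using not_less_Least[of m "\<lambda>m. m > 0 \<and> z ^ m = 1"] that unfolding d_def by blast
  have "z ^ n = z ^ (d * (n div d) + n mod d)" by simp
  also have "\<dots> = (z ^ d) ^ (n div d) * z ^ (n mod d)" by (simp only: power_add power_mult)
  finally have "z ^ (n mod d) = 1" using z d by simp
  hence "n mod d = 0" using min[of "n mod d"] d by (metis gr0I mod_less_divisor)
  thus "z \<in> (\<Union>d\<in>{d. d dvd n}. primitive_roots_of_unity d)"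
    using d min by (auto simp: primitive_roots_of_unity_def)
qed (auto simp: primitive_roots_of_unity_def power_mult elim!: dvdE)

lemma finite_primitive_roots:
  assumes "n > 0"
  shows "finite (primitive_roots_of_unity n)"
  by (rule finite_subset[OF _ finite_roots_unity[of n]])
     (use assms in \<open>auto simp: primitive_roots_of_unity_def\<close>)

lemma prod_complex_cyclotomic:
  assumes n: "n > 0"
  shows "(\<Prod>d\<in>{d. d dvd n}. complex_cyclotomic d) = monom 1 n - 1"
proof -
  let ?p = "monom 1 n - 1 :: complex poly"
  have p: "lead_coeff ?p = 1"
  proof -
    have "degree ?p = n"
      using degree_add_eq_left[of "- 1 :: complex poly" "monom 1 n"] n by (simp add: degree_monom_eq)
    thus ?thesis using n by simp
  qed
  have "rsquarefree ?p"
    unfolding rsquarefree_roots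
  proof (intro allI notI)
    fix a assume a: "poly ?p a = 0 \<and> poly (pderiv ?p) a = 0"
    hence "a ^ n = 1" by (simp add: poly_monom)
    moreover have "of_nat n * a ^ (n - 1) = 0"
      using a by (simp add: pderiv_diff pderiv_monom poly_monom)
    ultimately show False using n by (auto simp: power_0_left)
  qed
  from complex_poly_decompose_rsquarefree[OF this] p
  have "?p = (\<Prod>z\<in>{z. z ^ n = 1}. [:- z, 1:])" by (simp add: poly_monom)
  also have "\<dots> = (\<Prod>z\<in>(\<Union>d\<in>{d. d dvd n}. primitive_roots_of_unity d). [:- z, 1:])"
    by (simp only: roots_of_unity_eq_Union[OF n])
  also have "\<dots> = (\<Prod>d\<in>{d. d dvd n}. complex_cyclotomic d)"
    unfolding complex_cyclotomic_def
  proof (rule prod.UNION_disjoint)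
    have pos: "d > 0" if "d dvd n" for d using that n dvd_pos_nat by blast
    show "finite {d. d dvd n}" using n by simp
    show "\<forall>d\<in>{d. d dvd n}. finite (primitive_roots_of_unity d)"
      using finite_primitive_roots pos by blast
    show "\<forall>d\<in>{d. d dvd n}. \<forall>e\<in>{d. d dvd n}. d \<noteq> e \<longrightarrow>
            primitive_roots_of_unity d \<inter> primitive_roots_of_unity e = {}"
      using primitive_roots_disjoint pos by blast
  qed
  finally show ?thesis ..
qed

lemma map_poly_of_int_mult:
  "map_poly of_int (f * g) = (map_poly of_int f * map_poly of_int g :: complex poly)"
  by (intro poly_eqI) (simp add: coeff_map_poly coeff_mult)

lemma map_poly_of_int_prod:
  "map_poly of_int (prod f A) = (\<Prod>x\<in>A. map_poly of_int (f x) :: complex poly)"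
  by (induction A rule: infinite_finite_induct) (simp_all add: map_poly_of_int_mult)

lemma map_poly_of_int_eq_iff:
  "map_poly of_int f = (map_poly of_int g :: complex poly) \<longleftrightarrow> f = g"
  by (auto simp: poly_eq_iff coeff_map_poly)

lemma complex_cyclotomic_integral:
  assumes "n > 0"
  shows "\<exists>f. map_poly of_int f = complex_cyclotomic n"
  using assms
proof (induction n rule: less_induct)
  case (less n)
  let ?h = "map_poly of_int :: int poly \<Rightarrow> complex poly"
  define D where "D = {d. d dvd n} - {n}"
  have fin: "finite {d. d dvd n}" using less.prems by simp
  have D: "d < n \<and> d > 0" if "d \<in> D" for d
    using that less.prems by (auto simp: D_def dest: dvd_imp_le intro!: Nat.gr0I)
  then obtain F where F: "\<And>d. d \<in> D \<Longrightarrow> ?h (F d) = complex_cyclotomic d"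
    using less.IH by metis
  define P where "P = prod F D"
  have hP: "?h P = (\<Prod>d\<in>D. complex_cyclotomic d)"
    unfolding P_def map_poly_of_int_prod using F by (intro prod.cong) auto
  have deg: "degree (?h f) = degree f" for f by (rule degree_map_poly) auto
  have "lead_coeff (?h P) = 1"
    unfolding hP complex_cyclotomic_def by (simp add: lead_coeff_prod)
  hence lP: "lead_coeff P = 1" by (simp add: deg coeff_map_poly)
  hence P0: "P \<noteq> 0" by auto
  let ?X = "monom 1 n - 1 :: int poly"
  have X: "complex_cyclotomic n * ?h P = ?h ?X"
  proof -
    have "complex_cyclotomic n * ?h P = monom 1 n - 1"
      unfolding prod_complex_cyclotomic[OF less.prems, symmetric] hP D_def
      using fin by (subst prod.remove[of _ n]) auto
    also have "\<dots> = ?h ?X" by (intro poly_eqI) (simp add: coeff_map_poly)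
    finally show ?thesis .
  qed
  obtain Q R where QR: "pseudo_divmod ?X P = (Q, R)" by fastforce
  have Q: "?X = P * Q + R" and R: "R = 0 \<or> degree R < degree P"
    using pseudo_divmod[OF P0 QR] lP by simp_all
  have "?h ?X = ?h P * ?h Q + ?h R"
    unfolding Q map_poly_of_int_mult[symmetric] by (intro poly_eqI) (simp add: coeff_map_poly)
  hence eq: "?h P * (complex_cyclotomic n - ?h Q) = ?h R"
    using X by (simp add: algebra_simps)
  have "complex_cyclotomic n - ?h Q = 0"
  proof (rule ccontr)
    assume nz: "complex_cyclotomic n - ?h Q \<noteq> 0"
    have "?h P \<noteq> 0" using \<open>lead_coeff (?h P) = 1\<close> by auto
    hence "?h R \<noteq> 0" "degree (?h R) \<ge> degree (?h P)"
      unfolding eq[symmetric] using nz by (simp_all add: degree_mult_eq)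
    thus False using R by (auto simp: deg)
  qed
  thus ?case by (intro exI[of _ Q]) simp
qed

lemma map_poly_cyclotomic:
  assumes "n > 0"
  shows "map_poly of_int (cyclotomic n) = complex_cyclotomic n"
proof -
  obtain f where f: "map_poly of_int f = complex_cyclotomic n"
    using complex_cyclotomic_integral[OF assms] by blast
  show ?thesis unfolding cyclotomic_def
    by (rule theI[of _ f]) (use f map_poly_of_int_eq_iff in metis)+
qed

end

theory Submission
  imports Defs "HOL-Number_Theory.Cong"
begin

text \<open>
  Let $S$ be the numerical semigroup generated by $p$ and $q$.  The product formula for
  $X^{pq} - 1$ gives $(1 - X^p)\,\Phi_{pq} = (1 - X) \sum_{b<p} X^{bq}$, and the series
  $\sum_{s \in S} X^s$ multiplied by $1 - X^p$ is the same sum $\sum_{b<p} X^{bq}$.  Hence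
  $\Phi_{pq} = (1 - X) \sum_{s \in S} X^s$ (lemma \<open>coeff_eq_semigroup_difference\<close>): the
  coefficient at $n$ is nonzero exactly when one of $n - 1$, $n$ lies in $S$ and the other does
  not.  Two consecutive exponents are therefore the start of a maximal block of consecutive
  integers inside $S$ or inside its complement and the start of the next block, and a gap is the
  length of such a block (lemma \<open>consecutive_iff_run\<close>).

  The reflection $n \mapsto pq - p - q - n$ exchanges $S$ with its complement, so each length
  occurs equally often for the two kinds of blocks, and it suffices to study the blocks of
  non-members.  Write $q = kp + r$.  Such a block follows some $s = ap + bq \in S$.  If
  $a \ge k$, then $s + r = (a - k)p + (b + 1)q$ is in $S$ and the length is at most $r - 1$; if
  $b \ge 1$, then $s + p - r = (a + k + 1)p + (b - 1)q$ is in $S$ and the length is at most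
  $p - r - 1$; in the remaining case $s = ap$ with $a < k$, and the next member of $S$ is $s + p$
  (lemma \<open>complement_run_length\<close>).  So $p - 1$ is the largest length and
  $m = \max(r - 1, p - r - 1)$ bounds all others.  Finally, for each of the $k$ values
  $k \le j < 2k$, the only members of $S$ in $[jp, (j+1)p]$ are $jp$, $jp + r$ and $(j + 1)p$,
  so that $m$ occurs as the length of a block of non-members there
  (lemma \<open>complement_run_second_length\<close>).  Together with the reflected blocks, this gives $2k$
  gaps of length $m$.
\<close>

section \<open>Gaps as pairs of consecutive exponents\<close>

definition consecutive :: "nat set \<Rightarrow> nat \<Rightarrow> nat \<Rightarrow> bool" where
  "consecutive E e l \<longleftrightarrow> 0 < l \<and> e \<in> E \<and> e + l \<in> E \<and> (\<forall>i. e < i \<and> i < e + l \<longrightarrow> i \<notin> E)"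

text \<open>
  This replaces positions in the sorted list of exponents by the exponents themselves; the
  differences in that list are never zero, so the case \<open>l = 0\<close> is a bijection of empty sets.
\<close>
lemma bij_betw_indices_consecutive:
  fixes E :: "nat set"
  assumes "finite E"
  defines "xs \<equiv> sorted_list_of_set E"
  shows "bij_betw (\<lambda>j. xs ! j) {j. Suc j < length xs \<and> xs ! Suc j - xs ! j = l}
           {e. consecutive E e l}"
proof -
  have set: "set xs = E" and dist: "distinct xs" and sorted: "sorted_wrt (<) xs"
    using assms by simp_all
  have less: "xs ! i < xs ! j \<longleftrightarrow> i < j" if "i < length xs" "j < length xs" for i j
    using sorted_wrt_nth_less[OF sorted, of i j] sorted_wrt_nth_less[OF sorted, of j i] that
    by (metis linorder_neqE_nat order_less_asym order_less_irrefl)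
  show ?thesis
    unfolding bij_betw_def
  proof (intro conjI equalityI subsetI)
    show "inj_on (\<lambda>j. xs ! j) {j. Suc j < length xs \<and> xs ! Suc j - xs ! j = l}"
      using dist by (auto simp: inj_on_def nth_eq_iff_index_eq)
  next
    fix e assume "e \<in> (\<lambda>j. xs ! j) ` {j. Suc j < length xs \<and> xs ! Suc j - xs ! j = l}"
    then obtain j where j: "Suc j < length xs" "xs ! Suc j - xs ! j = l" "e = xs ! j" by blast
    have lt: "xs ! j < xs ! Suc j" using less[of j "Suc j"] j by simp
    have "i \<notin> E" if i: "xs ! j < i" "i < xs ! Suc j" for i
    proof
      assume "i \<in> E"
      then obtain k where "k < length xs" "xs ! k = i" using set by (metis in_set_conv_nth)
      thus False using less[of j k] less[of k "Suc j"] i j by simp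
    qed
    moreover have "e + l = xs ! Suc j" "0 < l" using j lt by simp_all
    moreover have "xs ! j \<in> E" "xs ! Suc j \<in> E" using set j by (metis Suc_lessD nth_mem)+
    ultimately show "e \<in> {e. consecutive E e l}" using j by (simp add: consecutive_def)
  next
    fix e assume "e \<in> {e. consecutive E e l}"
    hence e: "0 < l" "e \<in> E" "e + l \<in> E" and between: "\<And>i. e < i \<Longrightarrow> i < e + l \<Longrightarrow> i \<notin> E"
      by (auto simp: consecutive_def)
    obtain j k where j: "j < length xs" "xs ! j = e" and k: "k < length xs" "xs ! k = e + l"
      using e set by (metis in_set_conv_nth)
    have jk: "j < k" using less[of j k] j k e by simp
    have "k = Suc j"
    proof (rule ccontr)
      assume "k \<noteq> Suc j"
      hence "Suc j < k" using jk by simp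
      hence "xs ! j < xs ! Suc j" "xs ! Suc j < xs ! k" "xs ! Suc j \<in> E"
        using less[of j "Suc j"] less[of "Suc j" k] j k set nth_mem[of "Suc j" xs] by auto
      thus False using between j k by simp
    qed
    thus "e \<in> (\<lambda>j. xs ! j) ` {j. Suc j < length xs \<and> xs ! Suc j - xs ! j = l}"
      using j k by (intro image_eqI[of _ _ j]) auto
  qed
qed

lemma finite_support: "finite {i. coeff f i \<noteq> 0}"
  by (rule finite_subset[of _ "{..degree f}"]) (auto intro: le_degree)

lemma number_of_gaps_eq_card_consecutive:
  "number_of_gaps f l = card {e. consecutive {i. coeff f i \<noteq> 0} e l}"
  using bij_betw_same_card[OF bij_betw_indices_consecutive[OF finite_support[of f]]]
  by (simp add: number_of_gaps_def gap_at_def exponents_def)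

lemma mem_gapset_iff:
  "l \<in> gapset f \<longleftrightarrow> (\<exists>e. consecutive {i. coeff f i \<noteq> 0} e l)"
  using bij_betw_imp_surj_on[OF bij_betw_indices_consecutive[OF finite_support[of f], of l]]
  unfolding gapset_def gap_at_def exponents_def by blast

lemma finite_gapset: "finite (gapset f)"
proof -
  have "gapset f = gap_at f ` {j. Suc j < length (exponents f)}"
    by (auto simp: gapset_def)
  moreover have "finite {j. Suc j < length (exponents f)}"
    by (rule finite_subset[of _ "{..<length (exponents f)}"]) auto
  ultimately show ?thesis by simp
qed


section \<open>The semigroup generated by two coprime numbers\<close>

text \<open>A maximal block of \<open>l\<close> consecutive members of \<open>A\<close>.\<close>
definition run :: "int set \<Rightarrow> int \<Rightarrow> int \<Rightarrow> bool" where
  "run A e l \<longleftrightarrow> 0 < l \<and> {e..<e + l} \<subseteq> A \<and> e - 1 \<notin> A \<and> e + l \<notin> A"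

locale coprime_generators =
  fixes p q :: nat
  assumes coprime: "coprime p q" and p_gt_1: "1 < p" and p_less_q: "p < q"
begin

text \<open>
  The semigroup is taken inside the integers so that its complement is the mirror image of
  the semigroup; the negative numbers are the images of the members above $pq - p - q$.
\<close>
definition S :: "int set" where
  "S = {int a * int p + int b * int q | a b. True}"

lemma S_I: "0 \<le> a \<Longrightarrow> 0 \<le> b \<Longrightarrow> a * int p + b * int q \<in> S"
  unfolding S_def by (elim nonneg_int_cases) blast

lemma S_E:
  assumes "n \<in> S"
  obtains a b where "0 \<le> a" "0 \<le> b" "n = a * int p + b * int q"
proof -
  from assms obtain a b where "n = int a * int p + int b * int q" unfolding S_def by blast
  thus ?thesis using that[of "int a" "int b"] by simp
qed

lemma S_nonneg: "n \<in> S \<Longrightarrow> 0 \<le> n"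
  unfolding S_def by auto

lemma ex_normal_form:
  obtains a b where "0 \<le> b" "b < int p" "n = a * int p + b * int q"
proof -
  have "coprime (int q) (int p)" using coprime by (simp add: coprime_commute)
  then obtain x where x: "[int q * x = 1] (mod int p)"
    using cong_solve_coprime_int by blast
  define b where "b = (x * n) mod int p"
  have "[b * int q = x * n * int q] (mod int p)"
    unfolding b_def by (intro cong_mult) (auto simp: cong_def)
  also have "[x * n * int q = n] (mod int p)"
    using cong_mult[OF x cong_refl[of n]] by (simp add: ac_simps)
  finally have "int p dvd n - b * int q" by (metis cong_iff_dvd_diff cong_sym)
  then obtain a where "n = a * int p + b * int q" by (auto simp: dvd_def algebra_simps)
  moreover have "0 \<le> b" "b < int p" using p_gt_1 by (simp_all add: b_def)
  ultimately show ?thesis using that by blast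
qed

text \<open>
  Every other representation of $ap + bq$ has the form $(a - tq)p + (b + tp)q$, and its second
  coefficient is nonnegative only for $t \ge 0$: the normal form has the largest first
  coefficient among all representations with a nonnegative second one.
\<close>
lemma normal_form_mem_iff:
  assumes "0 \<le> b" "b < int p"
  shows "a * int p + b * int q \<in> S \<longleftrightarrow> 0 \<le> a"
proof
  assume "a * int p + b * int q \<in> S"
  then obtain a' b' where nn: "0 \<le> a'" "0 \<le> b'"
    and eq: "a * int p + b * int q = a' * int p + b' * int q" by (rule S_E)
  have "(b' - b) * int q = (a - a') * int p" using eq by (simp add: algebra_simps)
  hence "int p dvd (b' - b) * int q" by simp
  hence "int p dvd b' - b" using coprime by (simp add: coprime_dvd_mult_left_iff)
  then obtain t where t: "b' - b = int p * t" by (elim dvdE)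
  have "int p * (- 1) < int p * t" using t nn assms by simp
  hence "- 1 < t" by (rule mult_left_less_imp_less) simp
  hence "0 \<le> b' - b" using t by simp
  hence "0 \<le> (a - a') * int p"
    unfolding \<open>(b' - b) * int q = (a - a') * int p\<close>[symmetric] by simp
  hence "a' \<le> a" using p_gt_1 by (simp add: zero_le_mult_iff)
  thus "0 \<le> a" using nn by simp
qed (use assms S_I in auto)

text \<open>Replacing \<open>n\<close> by its mirror image replaces the normal form $(a, b)$ by $(-1-a,\, p-1-b)$.\<close>
lemma mirror_mem_iff: "int p * int q - int p - int q - n \<in> S \<longleftrightarrow> n \<notin> S"
proof -
  obtain a b where ab: "0 \<le> b" "b < int p" "n = a * int p + b * int q" by (rule ex_normal_form)
  have "int p * int q - int p - int q - n = (- 1 - a) * int p + (int p - 1 - b) * int q"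
    using ab by (simp add: algebra_simps)
  thus ?thesis using ab normal_form_mem_iff[of b a] normal_form_mem_iff[of "int p - 1 - b" "- 1 - a"]
    by auto
qed

lemma mirror_run:
  assumes "run A e l" "A = S \<or> A = - S"
  shows "run (- A) (int p * int q - int p - int q + 1 - e - l) l"
proof -
  let ?F = "int p * int q - int p - int q"
  have mem: "?F - i \<in> - A \<longleftrightarrow> i \<in> A" for i
    using mirror_mem_iff[of i] assms(2) by auto
  have "i \<in> - A" if "i \<in> {?F + 1 - e - l..<?F + 1 - e - l + l}" for i
  proof -
    have "?F - i \<in> A" using that assms(1) by (auto simp: run_def subset_iff)
    thus ?thesis using mem[of "?F - i"] by simp
  qed
  moreover have "?F + 1 - e - l - 1 = ?F - (e + l)" "?F + 1 - e - l + l = ?F - (e - 1)" by simp_all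
  ultimately show ?thesis using assms(1) mem[of "e + l"] mem[of "e - 1"]
    by (simp only: run_def subset_iff) simp
qed


section \<open>Lengths of the blocks of non-members\<close>

lemma q_eq: "int q = int (q div p) * int p + int (q mod p)"
  by (metis div_mult_mod_eq of_nat_add of_nat_mult)

lemma q_mod_p_bounds: "0 < q mod p" "q mod p < p"
proof -
  show "0 < q mod p"
    using coprime p_gt_1 by (metis coprime_absorb_left dvd_eq_mod_eq_0 nat_dvd_1_iff_1 nat_neq_iff neq0_conv)
  show "q mod p < p" using p_gt_1 by simp
qed

lemma quotient_ge_1: "1 \<le> q div p"
  using p_less_q p_gt_1 by (simp add: Suc_le_eq div_greater_zero_iff)

text \<open>
  The member \<open>e - 1\<close> of the semigroup is followed by a member at distance at most
  $q \bmod p$ or at most $p - (q \bmod p)$, unless it is a multiple of \<open>p\<close> so small that no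
  member involving \<open>q\<close> comes before the next multiple.
\<close>
lemma complement_run_length:
  assumes "run (- S) e l"
  shows "l = int p - 1 \<or> l \<le> int (max (q mod p - 1) (p - q mod p - 1))"
proof -
  let ?k = "int (q div p)" and ?r = "int (q mod p)"
  have l: "0 < l" and end_mem: "e + l \<in> S" and start: "e - 1 \<in> S"
    and non: "\<And>i. e \<le> i \<Longrightarrow> i < e + l \<Longrightarrow> i \<notin> S"
    using assms by (auto simp: run_def subset_iff)
  have bound: "l \<le> d - 1" if "e - 1 + d \<in> S" "0 < d" for d
    using non[of "e - 1 + d"] that by force
  obtain a b where ab: "0 \<le> a" "0 \<le> b" "e - 1 = a * int p + b * int q"
    using start by (rule S_E)
  consider "?k \<le> a" | "1 \<le> b" | "a < ?k" "b = 0" using ab by linarith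
  thus ?thesis
  proof cases
    case 1
    have "e - 1 + ?r = (a - ?k) * int p + (b + 1) * int q"
      using ab q_eq by (simp add: algebra_simps)
    hence "e - 1 + ?r \<in> S" using 1 ab S_I by simp
    hence "l \<le> ?r - 1" using bound q_mod_p_bounds by simp
    thus ?thesis using q_mod_p_bounds by (simp add: of_nat_diff)
  next
    case 2
    have "e - 1 + (int p - ?r) = (a + ?k + 1) * int p + (b - 1) * int q"
      using ab q_eq by (simp add: algebra_simps)
    hence "e - 1 + (int p - ?r) \<in> S" using 2 ab S_I by simp
    hence "l \<le> int p - ?r - 1" using bound q_mod_p_bounds by simp
    thus ?thesis using q_mod_p_bounds by (simp add: of_nat_diff)
  next
    case 3
    have "e - 1 + int p = (a + 1) * int p + 0 * int q" using ab 3 by (simp add: algebra_simps)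
    hence "e - 1 + int p \<in> S" using S_I[of "a + 1" 0] ab by simp
    hence le: "l \<le> int p - 1" using bound p_gt_1 by simp
    have "(a + 1) * int p \<le> ?k * int p" using 3 by (intro mult_right_mono) auto
    hence "e + l < int q"
      using le ab 3 q_eq q_mod_p_bounds by (simp add: algebra_simps)
    moreover obtain c d where cd: "0 \<le> c" "0 \<le> d" "e + l = c * int p + d * int q"
      using end_mem by (rule S_E)
    moreover have "0 \<le> c * int p" using cd by simp
    ultimately have "d * int q < 1 * int q" by linarith
    hence "d < 1" by (rule mult_right_less_imp_less) simp
    hence "l + 1 = (c - a) * int p" using cd ab 3 by (simp add: algebra_simps)
    moreover from this have "0 < c - a" using l p_gt_1 
      by (smt (verit) mult_nonpos_nonneg of_nat_0_le_iff)
    ultimately have "int p \<le> l + 1" using mult_right_mono[of 1 "c - a" "int p"] by simp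
    thus ?thesis using le by simp
  qed
qed

lemma complement_run_first_length: "run (- S) 1 (int p - 1)"
proof -
  have "i \<notin> S" if i: "1 \<le> i" "i < int p" for i
  proof
    assume "i \<in> S"
    then obtain a b where ab: "0 \<le> a" "0 \<le> b" "i = a * int p + b * int q" by (rule S_E)
    moreover from ab have "0 \<le> a * int p" "0 \<le> b * int q" by simp_all
    ultimately have "a * int p < 1 * int p" "b * int q < 1 * int q" using i p_less_q by linarith+
    hence "a < 1" "b < 1" using mult_right_less_imp_less of_nat_0_le_iff by blast+
    hence "a = 0" "b = 0" using ab by simp_all
    thus False using ab i by simp
  qed
  moreover have "0 \<in> S" "int p \<in> S" using S_I[of 0 0] S_I[of 1 0] by simp_all
  ultimately show ?thesis using p_gt_1 by (auto simp: run_def)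
qed

text \<open>Below $2q$, a member of the semigroup uses \<open>q\<close> at most once.\<close>
lemma mem_below_twice_q:
  assumes "n \<in> S" "n < 2 * int q" "int j * int p < n" "n < (int j + 1) * int p"
  shows "n = int j * int p + int (q mod p)"
proof -
  let ?k = "int (q div p)" and ?r = "int (q mod p)"
  obtain a b where ab: "0 \<le> a" "0 \<le> b" "n = a * int p + b * int q"
    using assms(1) by (rule S_E)
  moreover from ab have "0 \<le> a * int p" by simp
  ultimately have "b * int q < 2 * int q" using assms by linarith
  hence "b < 2" by (rule mult_right_less_imp_less) simp
  then consider "b = 0" | "b = 1" using ab by linarith
  thus ?thesis
  proof cases
    case 1
    hence "int j * int p < a * int p" "a * int p < (int j + 1) * int p" using ab assms by simp_all
    hence "int j < a" "a < int j + 1" by (auto dest: mult_right_less_imp_less)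
    thus ?thesis by simp
  next
    case 2
    hence n: "n = (a + ?k) * int p + ?r" using ab q_eq by (simp add: algebra_simps)
    moreover have "(a + ?k + 1) * int p = (a + ?k) * int p + int p" by (simp add: algebra_simps)
    ultimately have "int j * int p < (a + ?k + 1) * int p" "(a + ?k) * int p < (int j + 1) * int p"
      using assms q_mod_p_bounds by linarith+
    hence "int j < a + ?k + 1" "a + ?k < int j + 1" by (auto dest: mult_right_less_imp_less)
    hence "a + ?k = int j" by simp
    thus ?thesis using n by simp
  qed
qed

text \<open>Each level $[jp, (j+1)p]$ with $k \le j < 2k$ is cut by the semigroup at $jp + r$ only.\<close>
lemma complement_run_second_length:
  assumes j: "q div p \<le> j" "j < 2 * (q div p)"
    and m: "m = max (q mod p - 1) (p - q mod p - 1)" "0 < m"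
  shows "run (- S) (int (j * p + (if m = q mod p - 1 then 0 else q mod p) + 1)) (int m)"
proof -
  let ?k = "int (q div p)" and ?r = "int (q mod p)"
  have "(int j + 1) * int p \<le> (2 * ?k) * int p" using j by (intro mult_right_mono) auto
  hence top: "(int j + 1) * int p < 2 * int q" using q_eq q_mod_p_bounds by linarith
  have non: "n \<notin> S"
    if "int j * int p < n" "n < (int j + 1) * int p" "n \<noteq> int j * int p + ?r" for n
    using mem_below_twice_q[of n j] that top by auto
  have mem: "int j * int p \<in> S" "(int j + 1) * int p \<in> S"
    using S_I[of "int j" 0] S_I[of "int j + 1" 0] by simp_all
  have "int j * int p + ?r = (int j - ?k) * int p + 1 * int q"
    using q_eq by (simp add: algebra_simps)
  hence mid: "int j * int p + ?r \<in> S" using S_I[of "int j - ?k" 1] j by simp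
  show ?thesis
  proof (cases "m = q mod p - 1")
    case True
    have "int m = ?r - 1" using True q_mod_p_bounds by (simp add: of_nat_diff)
    thus ?thesis using True m mem mid non q_mod_p_bounds
      by (auto simp: run_def algebra_simps)
  next
    case False
    hence "int m = int p - ?r - 1" using m q_mod_p_bounds by (simp add: of_nat_diff max_def split: if_splits)
    thus ?thesis using False m mem mid non q_mod_p_bounds
      by (auto simp: run_def algebra_simps)
  qed
qed

end


section \<open>Coefficients of the binary cyclotomic polynomial\<close>

lemma binary_cyclotomic_product:
  fixes p q :: nat
  assumes "prime p" "prime q" "p \<noteq> q"
  shows "cyclotomic (p * q) * ((monom 1 p - 1) * (monom 1 q - 1)) =
           (monom 1 (p * q) - 1) * (monom 1 1 - 1)"
proof -
  let ?h = "map_poly of_int :: int poly \<Rightarrow> complex poly" and ?C = complex_cyclotomic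
  have pos: "0 < p" "0 < q" and ne: "p \<noteq> 1" "q \<noteq> 1"
    using assms by (auto simp: prime_gt_0_nat)
  have d1: "{d. d dvd (1::nat)} = {1}" by auto
  have dp: "{d. d dvd p} = {1, p}" "{d. d dvd q} = {1, q}"
    using assms by (auto simp: prime_nat_iff)
  have dpq: "{d. d dvd p * q} = {1, p, q, p * q}"
  proof (intro equalityI subsetI)
    fix d assume "d \<in> {d. d dvd p * q}"
    hence "d dvd p * q" by simp
    then obtain x y where "d = x * y" "x dvd p" "y dvd q" using division_decomp by blast
    moreover from this have "x \<in> {1, p}" "y \<in> {1, q}" using dp by blast+
    ultimately show "d \<in> {1, p, q, p * q}" by auto
  qed auto
  have 1: "?C 1 = monom 1 1 - 1" using prod_complex_cyclotomic[of 1] d1 by simp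
  have 2: "?C 1 * ?C p = monom 1 p - 1" "?C 1 * ?C q = monom 1 q - 1"
    using prod_complex_cyclotomic[of p] prod_complex_cyclotomic[of q] dp pos ne by simp_all
  have 3: "?C 1 * (?C p * (?C q * ?C (p * q))) = monom 1 (p * q) - 1"
    using prod_complex_cyclotomic[of "p * q"] dpq pos ne assms by simp
  have mon: "?h (monom 1 n - 1) = monom 1 n - 1" for n
    by (intro poly_eqI) (simp add: coeff_map_poly)
  have "?h (cyclotomic (p * q) * ((monom 1 p - 1) * (monom 1 q - 1))) =
      ?C (p * q) * ((?C 1 * ?C p) * (?C 1 * ?C q))"
    unfolding map_poly_of_int_mult mon 2 using pos by (simp add: map_poly_cyclotomic)
  also have "\<dots> = (?C 1 * (?C p * (?C q * ?C (p * q)))) * ?C 1" by (simp only: ac_simps)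
  also have "\<dots> = ?h ((monom 1 (p * q) - 1) * (monom 1 1 - 1))"
    unfolding map_poly_of_int_mult mon 3 by (simp only: 1)
  finally show ?thesis by (simp only: map_poly_of_int_eq_iff)
qed

text \<open>Cancelling $X^q - 1$ leaves only one binomial on the left, hence a recursion with step \<open>p\<close>.\<close>
lemma binary_cyclotomic_recursion:
  fixes p q :: nat
  assumes "prime p" "prime q" "p \<noteq> q"
  shows "cyclotomic (p * q) * (1 - monom 1 p) = (1 - monom 1 1) * (\<Sum>b<p. monom 1 (b * q))"
proof -
  let ?Q = "monom 1 q - 1 :: int poly"
  have "(monom 1 q) ^ p - 1 = ?Q * (\<Sum>b<p. (monom 1 q) ^ b)" by (rule power_diff_1_eq)
  hence geo: "monom 1 (p * q) - 1 = ?Q * (\<Sum>b<p. monom 1 (b * q))"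
    by (simp add: monom_power mult.commute)
  have "?Q * (cyclotomic (p * q) * (1 - monom 1 p)) =
      - (cyclotomic (p * q) * ((monom 1 p - 1) * ?Q))" by (simp add: algebra_simps)
  also have "\<dots> = ?Q * ((1 - monom 1 1) * (\<Sum>b<p. monom 1 (b * q)))"
    unfolding binary_cyclotomic_product[OF assms] geo by (simp add: algebra_simps)
  finally have "?Q * (cyclotomic (p * q) * (1 - monom 1 p)) =
    ?Q * ((1 - monom 1 1) * (\<Sum>b<p. monom 1 (b * q)))" .
  moreover have "?Q \<noteq> 0"
  proof
    assume "?Q = 0"
    hence "coeff ?Q 0 = 0" by simp
    thus False using assms prime_gt_0_nat[of q] by simp
  qed
  ultimately show ?thesis by simp
qed

context coprime_generators
begin

text \<open>
  Subtracting \<open>p\<close> lowers the first coefficient of the normal form by one, so \<open>n\<close> is a member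
  and $n - p$ is not exactly when that coefficient is zero.
\<close>
lemma indicator_S_diff:
  "of_bool (n \<in> S) - of_bool (n - int p \<in> S) = (\<Sum>b<p. of_bool (int (b * q) = n) :: int)"
proof -
  obtain a b where ab: "0 \<le> b" "b < int p" and n: "n = a * int p + b * int q" by (rule ex_normal_form)
  have n': "n - int p = (a - 1) * int p + b * int q" using n by (simp add: algebra_simps)
  have "int (c * q) = n \<longleftrightarrow> a = 0 \<and> c = nat b" if c: "c < p" for c
  proof
    assume eq: "int (c * q) = n"
    have "n \<in> S" using S_I[of 0 "int c"] eq by simp
    hence "0 \<le> a" using normal_form_mem_iff[OF ab] n by simp
    moreover have "- a * int p + int c * int q \<in> S"
      using S_I[of 0 b] ab eq n by simp
    hence "0 \<le> - a" using normal_form_mem_iff[of "int c" "- a"] c by simp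
    ultimately have "a = 0" by simp
    thus "a = 0 \<and> c = nat b" using eq n p_less_q by auto
  qed (use ab n in auto)
  hence "(\<Sum>c<p. of_bool (int (c * q) = n) :: int) = (\<Sum>c<p. if c = nat b then of_bool (a = 0) else 0)"
    by (intro sum.cong) auto
  also have "\<dots> = of_bool (a = 0)" using ab by (simp add: nat_less_iff)
  also have "\<dots> = of_bool (n \<in> S) - of_bool (n - int p \<in> S)"
    unfolding n' using normal_form_mem_iff[OF ab] by (auto simp: n)
  finally show ?thesis ..
qed

text \<open>
  The right-hand side satisfies the same recursion with step \<open>p\<close> as the coefficients, and it
  vanishes at negative arguments.
\<close>
lemma coeff_eq_semigroup_difference:
  assumes "prime p" "prime q"
  shows "coeff (cyclotomic (p * q)) n = of_bool (int n \<in> S) - of_bool (int n - 1 \<in> S)"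
proof (induction n rule: less_induct)
  case (less n)
  let ?f = "cyclotomic (p * q)" and ?T = "(\<Sum>b<p. monom 1 (b * q)) :: int poly"
  let ?s = "\<lambda>i. of_bool (i \<in> S) :: int"
  have T: "coeff ?T i = ?s (int i) - ?s (int i - int p)" for i
    unfolding indicator_S_diff by (simp add: coeff_sum of_bool_def del: of_nat_mult)
  have neg: "?s i = 0" if "i < 0" for i using S_nonneg[of i] that by auto
  have "coeff (?f * (1 - monom 1 p)) n = coeff ?f n - (if n < p then 0 else coeff ?f (n - p))"
    by (simp add: right_diff_distrib coeff_monom_mult mult.commute[of ?f])
  moreover have "coeff ((1 - monom 1 1) * ?T) n = coeff ?T n - (if n < 1 then 0 else coeff ?T (n - 1))"
    by (simp only: left_diff_distrib coeff_diff coeff_monom_mult) auto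
  moreover have "?f * (1 - monom 1 p) = (1 - monom 1 1) * ?T"
    by (rule binary_cyclotomic_recursion) (use assms p_less_q in auto)
  ultimately have rec: "coeff ?f n = (if n < p then 0 else coeff ?f (n - p)) + coeff ?T n
      - (if n < 1 then 0 else coeff ?T (n - 1))" by simp
  have prev: "(if n < p then 0 else coeff ?f (n - p)) = ?s (int n - int p) - ?s (int n - int p - 1)"
    using less.IH[of "n - p"] p_gt_1 by (auto simp: of_nat_diff neg)
  have shift: "(if n < 1 then 0 else coeff ?T (n - 1)) = ?s (int n - 1) - ?s (int n - 1 - int p)"
    using T[of "n - 1"] neg[of "- 1"] neg[of "- 1 - int p"] by (cases n) simp_all
  show ?case using rec prev shift T[of n] by (simp add: algebra_simps)
qed

text \<open>
  The nonzero coefficients are at the places where membership changes, so membership is constant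
  from one exponent up to just before the next.
\<close>
lemma consecutive_iff_run:
  assumes "prime p" "prime q"
  shows "consecutive {i. coeff (cyclotomic (p * q)) i \<noteq> 0} e l \<longleftrightarrow>
    run S (int e) (int l) \<or> run (- S) (int e) (int l)"
proof -
  have E: "i \<in> {i. coeff (cyclotomic (p * q)) i \<noteq> 0} \<longleftrightarrow> (int i \<in> S) \<noteq> (int i - 1 \<in> S)" for i
    using coeff_eq_semigroup_difference[OF assms, of i] by auto
  have const: "(int e + int i \<in> S) = (int e \<in> S)"
    if "\<forall>i. e < i \<and> i < e + l \<longrightarrow> (int i \<in> S) = (int i - 1 \<in> S)" "i < l" for i
    using that(2)
  proof (induction i)
    case (Suc i)
    thus ?case using that(1)[rule_format, of "e + Suc i"] by (simp add: ac_simps)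
  qed simp
  show ?thesis
  proof
    assume "consecutive {i. coeff (cyclotomic (p * q)) i \<noteq> 0} e l"
    hence c: "0 < l" "(int e \<in> S) \<noteq> (int e - 1 \<in> S)" "(int (e + l) \<in> S) \<noteq> (int (e + l) - 1 \<in> S)"
      "\<forall>i. e < i \<and> i < e + l \<longrightarrow> (int i \<in> S) = (int i - 1 \<in> S)"
      unfolding consecutive_def E by auto
    have inside: "(i \<in> S) = (int e \<in> S)" if "i \<in> {int e..<int e + int l}" for i
      using const[OF c(4), of "nat (i - int e)"] that by auto
    have "(int (e + l) - 1 \<in> S) = (int e \<in> S)" using inside[of "int (e + l) - 1"] c(1) by auto
    hence last: "int e + int l \<in> S \<longleftrightarrow> int e \<notin> S" using c(3) by simp
    show "run S (int e) (int l) \<or> run (- S) (int e) (int l)"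
    proof (cases "int e \<in> S")
      case True
      hence "{int e..<int e + int l} \<subseteq> S" using inside by blast
      thus ?thesis using True c(1,2) last by (simp add: run_def)
    next
      case False
      hence "{int e..<int e + int l} \<subseteq> - S" using inside by blast
      thus ?thesis using False c(1,2) last by (simp add: run_def)
    qed
  next
    assume "run S (int e) (int l) \<or> run (- S) (int e) (int l)"
    then obtain A where A: "A = S \<or> A = - S" and run: "run A (int e) (int l)" by blast
    have E': "i \<in> {i. coeff (cyclotomic (p * q)) i \<noteq> 0} \<longleftrightarrow> (int i \<in> A) \<noteq> (int i - 1 \<in> A)" for i
      using A unfolding E by auto
    have inside: "int e + i \<in> A" if "0 \<le> i" "i < int l" for i
      using run that by (auto simp: run_def subset_iff)
    have l: "0 < l" and ends: "int e - 1 \<notin> A" "int (e + l) \<notin> A" using run by (simp_all add: run_def)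
    have "int e \<in> A" "int (e + l) - 1 \<in> A"
      using inside[of 0] inside[of "int l - 1"] l by (simp_all add: algebra_simps)
    moreover have "(int i \<in> A) = (int i - 1 \<in> A)" if "e < i" "i < e + l" for i
      using inside[of "int i - int e"] inside[of "int i - int e - 1"] that by simp
    ultimately show "consecutive {i. coeff (cyclotomic (p * q)) i \<noteq> 0} e l"
      unfolding consecutive_def E' using ends l by blast
  qed
qed

text \<open>By reflection, the blocks of members have no other lengths than the blocks of non-members.\<close>
lemma mem_gapset_iff_complement_run:
  assumes "prime p" "prime q"
  shows "l \<in> gapset (cyclotomic (p * q)) \<longleftrightarrow> (\<exists>e. run (- S) e (int l))"
proof
  assume "l \<in> gapset (cyclotomic (p * q))"
  then obtain e where "run S (int e) (int l) \<or> run (- S) (int e) (int l)"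
    unfolding mem_gapset_iff consecutive_iff_run[OF assms] by blast
  thus "\<exists>e. run (- S) e (int l)" using mirror_run[of S] mirror_run[of "- S"] by blast
next
  assume "\<exists>e. run (- S) e (int l)"
  then obtain e where e: "run (- S) e (int l)" by blast
  hence "e - 1 \<in> S" by (simp add: run_def)
  hence "e = int (nat e)" using S_nonneg[of "e - 1"] by simp
  thus "l \<in> gapset (cyclotomic (p * q))"
    unfolding mem_gapset_iff consecutive_iff_run[OF assms] using e by metis
qed

text \<open>
  A block of non-members and the reflection of another one cannot start at the same place, as
  the reflection starts with a member; so reflecting doubles the count.
\<close>
lemma number_of_gaps_ge:
  assumes "prime p" "prime q"
    and A: "finite A" "\<And>e. e \<in> A \<Longrightarrow> run (- S) (int e) (int l)"
  shows "2 * card A \<le> number_of_gaps (cyclotomic (p * q)) l"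
proof -
  let ?f = "cyclotomic (p * q)"
  let ?C = "{e. consecutive {i. coeff ?f i \<noteq> 0} e l}"
  define \<mu> where "\<mu> e = int p * int q - int p - int q + 1 - int e - int l" for e
  have \<mu>: "run S (\<mu> e) (int l)" "0 \<le> \<mu> e" if "e \<in> A" for e
  proof -
    show run: "run S (\<mu> e) (int l)" using mirror_run[OF A(2)[OF that]] by (simp add: \<mu>_def)
    hence "\<mu> e \<in> S" by (auto simp: run_def subset_iff)
    thus "0 \<le> \<mu> e" by (rule S_nonneg)
  qed
  have inj: "inj_on (\<lambda>e. nat (\<mu> e)) A"
  proof (rule inj_onI)
    fix x y assume "x \<in> A" "y \<in> A" "nat (\<mu> x) = nat (\<mu> y)"
    hence "\<mu> x = \<mu> y" using \<mu>(2) by (metis eq_nat_nat_iff)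
    thus "x = y" by (simp add: \<mu>_def)
  qed
  have "A \<inter> (\<lambda>e. nat (\<mu> e)) ` A = {}"
  proof -
    have "int e \<notin> S" if "e \<in> A" for e using A(2)[OF that] by (auto simp: run_def subset_iff)
    moreover have "int (nat (\<mu> e)) \<in> S" if "e \<in> A" for e
      using \<mu>[OF that] by (auto simp: run_def subset_iff)
    ultimately show ?thesis by blast
  qed
  hence "card (A \<union> (\<lambda>e. nat (\<mu> e)) ` A) = 2 * card A"
    using A(1) by (simp add: card_Un_disjoint card_image[OF inj])
  moreover have "A \<union> (\<lambda>e. nat (\<mu> e)) ` A \<subseteq> ?C"
    using A(2) \<mu> by (auto simp: consecutive_iff_run[OF assms(1,2)])
  moreover have "finite ?C"
    by (rule finite_subset[OF _ finite_support[of ?f]]) (auto simp: consecutive_def)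
  ultimately show ?thesis
    unfolding number_of_gaps_eq_card_consecutive by (metis card_mono)
qed

end


section \<open>The second gap\<close>

theorem theorem1p1:
  fixes p q :: nat
  assumes "prime p" and "prime q" and "p < q" and "5 \<le> p"
  shows "has_second_gap (cyclotomic (p * q)) \<and>
    second_gap (cyclotomic (p * q)) = max (q mod p - 1) (p - q mod p - 1) \<and>
    2 * (q div p) \<le> number_of_gaps (cyclotomic (p * q)) (second_gap (cyclotomic (p * q)))"
proof -
  interpret coprime_generators p q
    by standard (use assms primes_coprime[of p q] in auto)
  let ?f = "cyclotomic (p * q)"
  define k where "k = q div p"
  define m where "m = max (q mod p - 1) (p - q mod p - 1)"
  have m: "2 \<le> m" "m < p - 1"
    unfolding m_def using q_mod_p_bounds assms(4) by linarith+
  \<comment> \<open>A block of length $r - 1$ follows $jp$; one of length $p - r - 1$ follows $jp + r$.\<close>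
  define start where "start j = j * p + (if m = q mod p - 1 then 0 else q mod p) + 1" for j
  have runs: "run (- S) (int (start j)) (int m)" if "j \<in> {k..<2 * k}" for j
    using complement_run_second_length[OF _ _ m_def] that m by (simp add: k_def start_def)
  have m_gap: "m \<in> gapset ?f"
    unfolding mem_gapset_iff_complement_run[OF assms(1,2)]
    using runs[of k] quotient_ge_1 by (auto simp: k_def)
  have p_gap: "p - 1 \<in> gapset ?f"
    unfolding mem_gapset_iff_complement_run[OF assms(1,2)]
    using complement_run_first_length p_gt_1 by (auto simp: of_nat_diff)
  have gaps: "l = p - 1 \<or> l \<le> m" if "l \<in> gapset ?f" for l
    using that complement_run_length unfolding mem_gapset_iff_complement_run[OF assms(1,2)] m_def
    by (force simp: of_nat_diff)
  have first: "first_gap ?f = p - 1"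
    unfolding first_gap_def
    by (rule Max_eqI) (use finite_gapset p_gap gaps m in force)+
  have second: "second_gap ?f = m"
    unfolding second_gap_def first
    by (rule Max_eqI) (use finite_gapset m_gap gaps m in auto)
  have "has_second_gap ?f"
    unfolding has_second_gap_def first using m_gap m by (intro bexI[of _ m]) auto
  moreover have "2 * k \<le> number_of_gaps ?f m"
  proof -
    have "inj_on start {k..<2 * k}" using p_gt_1 by (auto simp: inj_on_def start_def)
    hence "card (start ` {k..<2 * k}) = k" by (simp add: card_image)
    thus ?thesis
      using number_of_gaps_ge[OF assms(1,2), of "start ` {k..<2 * k}" m] runs by force
  qed
  ultimately show ?thesis unfolding second by (simp add: m_def k_def)
qed

end
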